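(* Let $\xi=(\mathcal{E},p,T)$ be a Banach bundle and suppose that the base space $T$ is pseudo-complete and locally paracompact. Then $\mathcal{E}$ is a Baire space.
   Context: $\mathbb{K}$ is the real or the complex field. A Banach bundle $\xi=(\mathcal{E},p,T)$ consists of a Hausdorff space $T$ (base space), a topological space $\mathcal{E}$ (bundle space, not assumed Hausdorff), and a continuous open surjection $p:\mathcal{E}\to T$ such that each fiber $\mathcal{E}(t)=p^{-1}(t)$ is a Banach space over $\mathbb{K}$ with origin $0_t$, and: addition $\{(x,y)\in\mathcal{E}\times\mathcal{E}: p(x)=p(y)\}\to\mathcal{E}$ and scalar multiplication $\mathbb{K}\times\mathcal{E}\to\mathcal{E}$ are continuous; $x\mapsto\|x\|$ is upper semi-continuous on $\mathcal{E}$; and if $(x_\iota)$ is a net in $\mathcal{E}$ with $p(x_\iota)\to t$ and $\|x_\iota\|\to 0$, then $x_\iota\to 0_t$. Paracompact spaces are assumed Hausdorff; a space is locally paracompact if it has a cover by open subsets whose closures are paracompact. A family $\mathcal{B}$ of non-void open subsets of a topological space is a pseudo-base if every non-void open subset contains an element of $\mathcal{B}$. A space $Z$ is quasi-regular if each non-void open set contains the closure of some non-void open set. $Z$ is pseudo-complete if it is quasi-regular and there is a sequence $\{\mathcal{B}_n\}$ of pseudo-bases of $Z$ such that whenever $U_n\in\mathcal{B}_n$ and $\overline{U_{n+1}}\subset U_n$ for $n=1,2,\ldots$, then $\bigcap_n U_n\neq\emptyset$. *)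

theory Defs
  imports "HOL-Analysis.Analysis"
begin

definition Baire_space :: "'a topology \<Rightarrow> bool" where
  "Baire_space X \<longleftrightarrow>
    (\<forall>\<G>. countable \<G> \<and> (\<forall>U\<in>\<G>. openin X U \<and> X closure_of U = topspace X)
       \<longrightarrow> X closure_of (\<Inter>\<G>) = topspace X)"

definition paracompact_space :: "'a topology \<Rightarrow> bool" where
  "paracompact_space X \<longleftrightarrow>
    Hausdorff_space X \<and>
    (\<forall>\<U>. (\<forall>U\<in>\<U>. openin X U) \<and> \<Union>\<U> = topspace X
       \<longrightarrow> (\<exists>\<V>. (\<forall>V\<in>\<V>. openin X V) \<and> \<Union>\<V> = topspace X \<and>
                 (\<forall>V\<in>\<V>. \<exists>U\<in>\<U>. V \<subseteq> U) \<and> locally_finite_in X \<V>))"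

definition locally_paracompact_space :: "'a topology \<Rightarrow> bool" where
  "locally_paracompact_space X \<longleftrightarrow>
    (\<exists>\<U>. (\<forall>U\<in>\<U>. openin X U \<and> paracompact_space (subtopology X (X closure_of U))) \<and>
         \<Union>\<U> = topspace X)"

definition pseudo_base :: "'a topology \<Rightarrow> 'a set set \<Rightarrow> bool" where
  "pseudo_base X \<B> \<longleftrightarrow>
    (\<forall>B\<in>\<B>. openin X B \<and> B \<noteq> {}) \<and>
    (\<forall>U. openin X U \<and> U \<noteq> {} \<longrightarrow> (\<exists>B\<in>\<B>. B \<subseteq> U))"

definition quasi_regular_space :: "'a topology \<Rightarrow> bool" where
  "quasi_regular_space X \<longleftrightarrow>
    (\<forall>U. openin X U \<and> U \<noteq> {} \<longrightarrow> (\<exists>V. openin X V \<and> V \<noteq> {} \<and> X closure_of V \<subseteq> U))"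

definition pseudo_complete_space :: "'a topology \<Rightarrow> bool" where
  "pseudo_complete_space X \<longleftrightarrow>
    quasi_regular_space X \<and>
    (\<exists>\<B> :: nat \<Rightarrow> 'a set set.
       (\<forall>n. pseudo_base X (\<B> n)) \<and>
       (\<forall>U. (\<forall>n. U n \<in> \<B> n \<and> X closure_of (U (Suc n)) \<subseteq> U n) \<longrightarrow> (\<Inter>n. U n) \<noteq> {}))"

text \<open>
  The scalars range over an arbitrary type \<open>'k\<close> of class \<open>real_normed_field\<close>. The norm of
  this class is multiplicative, so by Mazur's theorem such a type is, up to isometric
  isomorphism, either the real or the complex field. Both \<open>real\<close> and \<open>complex\<close> are instances.
\<close>

locale banach_space_on =
  fixes V :: "'e set"
    and add :: "'e \<Rightarrow> 'e \<Rightarrow> 'e"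
    and origin :: 'e
    and smult :: "'k::real_normed_field \<Rightarrow> 'e \<Rightarrow> 'e"
    and nrm :: "'e \<Rightarrow> real"
  assumes add_closed: "\<lbrakk>x \<in> V; y \<in> V\<rbrakk> \<Longrightarrow> add x y \<in> V"
    and origin_closed: "origin \<in> V"
    and smult_closed: "x \<in> V \<Longrightarrow> smult c x \<in> V"
    and add_assoc: "\<lbrakk>x \<in> V; y \<in> V; z \<in> V\<rbrakk> \<Longrightarrow> add (add x y) z = add x (add y z)"
    and add_commute: "\<lbrakk>x \<in> V; y \<in> V\<rbrakk> \<Longrightarrow> add x y = add y x"
    and add_origin: "x \<in> V \<Longrightarrow> add x origin = x"
    and add_inverse: "x \<in> V \<Longrightarrow> \<exists>y\<in>V. add x y = origin"
    and smult_add_right: "\<lbrakk>x \<in> V; y \<in> V\<rbrakk> \<Longrightarrow> smult c (add x y) = add (smult c x) (smult c y)"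
    and smult_add_left: "x \<in> V \<Longrightarrow> smult (c + d) x = add (smult c x) (smult d x)"
    and smult_smult: "x \<in> V \<Longrightarrow> smult c (smult d x) = smult (c * d) x"
    and smult_one: "x \<in> V \<Longrightarrow> smult 1 x = x"
    and nrm_nonneg: "x \<in> V \<Longrightarrow> 0 \<le> nrm x"
    and nrm_eq_0: "x \<in> V \<Longrightarrow> nrm x = 0 \<longleftrightarrow> x = origin"
    and nrm_triangle: "\<lbrakk>x \<in> V; y \<in> V\<rbrakk> \<Longrightarrow> nrm (add x y) \<le> nrm x + nrm y"
    and nrm_smult: "x \<in> V \<Longrightarrow> nrm (smult c x) = norm c * nrm x"
    and complete:
      "\<lbrakk>\<And>n::nat. s n \<in> V;
        \<And>e. e > 0 \<Longrightarrow> \<exists>N. \<forall>m\<ge>N. \<forall>n\<ge>N. nrm (add (s m) (smult (- 1) (s n))) < e\<rbrakk>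
       \<Longrightarrow> \<exists>l\<in>V. (\<lambda>n. nrm (add (s n) (smult (- 1) l))) \<longlonglongrightarrow> 0"

text \<open>
  The operations \<open>add\<close>, \<open>smult\<close> and \<open>nrm\<close> are total functions on the type of the bundle space,
  but only their values on \<open>topspace E\<close> matter, and those of \<open>add\<close> only on pairs of points in a
  common fiber. The origin of the fiber over \<open>t\<close> is \<open>origin t\<close>.

  In \<open>origin_limit\<close> a net in the bundle space is represented by its eventuality filter \<open>F\<close>; every
  filter other than \<open>bot\<close> arises from a net in this way, and \<open>bot\<close> satisfies the conclusion
  trivially.
\<close>

locale banach_bundle =
  fixes E :: "'e topology"
    and p :: "'e \<Rightarrow> 't"
    and T :: "'t topology"
    and add :: "'e \<Rightarrow> 'e \<Rightarrow> 'e"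
    and origin :: "'t \<Rightarrow> 'e"
    and smult :: "'k::real_normed_field \<Rightarrow> 'e \<Rightarrow> 'e"
    and nrm :: "'e \<Rightarrow> real"
  assumes Hausdorff_base: "Hausdorff_space T"
    and continuous_proj: "continuous_map E T p"
    and open_proj: "open_map E T p"
    and surj_proj: "p ` topspace E = topspace T"
    and banach_fiber:
      "t \<in> topspace T \<Longrightarrow> banach_space_on {x \<in> topspace E. p x = t} add (origin t) smult nrm"
    and continuous_add:
      "continuous_map (subtopology (prod_topology E E) {(x, y). p x = p y}) E (\<lambda>(x, y). add x y)"
    and continuous_smult:
      "continuous_map (prod_topology euclidean E) E (\<lambda>(c, x). smult c x)"
    and upper_semicontinuous_nrm: "openin E {x \<in> topspace E. nrm x < r}"
    and origin_limit:
      "\<lbrakk>t \<in> topspace T; eventually (\<lambda>x. x \<in> topspace E) F; limitin T p t F; (nrm \<longlongrightarrow> 0) F\<rbrakk>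
       \<Longrightarrow> limitin E (\<lambda>x. x) (origin t) F"

end

(* Every point of an open set W has a neighbourhood W' with fibrewise diameter as small as
   desired and with a uniform fibrewise e-neighbourhood inside W: addition is continuous at
   (x, 0), and the tubes {z. p z : V, |z| < e} form a neighbourhood base of the origin of a
   fibre. Shrink a nested sequence of such sets so that their projections are nested members of
   the given pseudo-bases. Pseudo-completeness gives a fibre meeting all of the sets, and
   completeness of that one fibre gives a point in all of them. *)

theory Submission
  imports Defs
begin

text \<open>Density means meeting every nonempty open set, and a nonempty countable family is the
  range of a sequence, possibly with repetitions. Hence a construction by recursion on
  \<open>n\<close> suffices.\<close>

lemma Baire_spaceI:
  assumes "\<And>G O'. \<lbrakk>\<And>n::nat. openin X (G n); \<And>n. X closure_of G n = topspace X;
             openin X O'; O' \<noteq> {}\<rbrakk> \<Longrightarrow> \<exists>x\<in>O'. \<forall>n. x \<in> G n"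
  shows "Baire_space X"
  unfolding Baire_space_def
proof (intro allI impI, elim conjE)
  fix \<G> assume cnt: "countable \<G>" and \<G>: "\<forall>U\<in>\<G>. openin X U \<and> X closure_of U = topspace X"
  show "X closure_of (\<Inter>\<G>) = topspace X"
  proof (cases "\<G> = {}")
    case True
    \<comment> \<open>\<open>\<Inter>{}\<close> is \<open>UNIV\<close>, which may exceed the
      carrier; \<open>closure_of_restrict\<close> cuts it down to \<open>topspace X\<close>.\<close>
    then show ?thesis by (simp add: closure_of_restrict[of X UNIV])
  next
    case False
    have "\<exists>x\<in>O'. x \<in> \<Inter>\<G>" if "openin X O'" "O' \<noteq> {}" for O'
    proof -
      have "\<exists>x\<in>O'. \<forall>n. x \<in> from_nat_into \<G> n"
        using assms[of "from_nat_into \<G>" O'] \<G> that from_nat_into[OF False] by blast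
      then show ?thesis
        using range_from_nat_into[OF False cnt] by (metis INT_iff UNIV_I)
    qed
    then show ?thesis
      by (auto simp: dense_intersects_open) blast
  qed
qed

section \<open>Subtraction in a single fiber\<close>

context banach_space_on
begin

text \<open>Distributivity turns the difference into \<open>smult 0 x\<close>; its norm is
  \<open>0\<close> by homogeneity, and only the origin has norm \<open>0\<close>.\<close>

lemma diff_self:
  assumes "x \<in> V" shows "add x (smult (- 1) x) = origin"
proof -
  have "add x (smult (- 1) x) = smult (1 + - 1) x"
    using smult_add_left[OF assms, of 1 "- 1"] smult_one[OF assms] by simp
  moreover have "nrm (smult 0 x) = 0"
    using nrm_smult[OF assms, of 0] by simp
  ultimately show ?thesis
    using nrm_eq_0[OF smult_closed[OF assms]] by simp
qed

lemma diff_closed: "x \<in> V \<Longrightarrow> y \<in> V \<Longrightarrow> add x (smult (- 1) y) \<in> V"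
  by (simp add: add_closed smult_closed)

text \<open>This recovers a point from its difference to \<open>x\<close>, so that smallness of a
  difference can be used to locate the point itself.\<close>

lemma add_diff_cancel:
  assumes "x \<in> V" "y \<in> V"
  shows "add x (smult (- 1) (add x (smult (- 1) y))) = y"
proof -
  let ?m = "smult (- 1)"
  have "?m (add x (?m y)) = add (?m x) y"
    using assms by (simp add: smult_add_right smult_closed smult_smult smult_one)
  then have "add x (?m (add x (?m y))) = add (add x (?m x)) y"
    using assms by (simp add: add_assoc smult_closed)
  also have "\<dots> = y"
    using assms by (simp add: diff_self add_commute[OF origin_closed] add_origin)
  finally show ?thesis .
qed

end

section \<open>Fiberwise subtraction and tubes around the origins\<close>

context banach_bundle
begin

lemma proj_mem: "x \<in> topspace E \<Longrightarrow> p x \<in> topspace T"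
  using surj_proj by blast

lemma fiber: "x \<in> topspace E \<Longrightarrow> banach_space_on {y \<in> topspace E. p y = p x} add (origin (p x)) smult nrm"
  by (intro banach_fiber proj_mem)

lemma smult_mem: "x \<in> topspace E \<Longrightarrow> smult c x \<in> topspace E \<and> p (smult c x) = p x"
  using banach_space_on.smult_closed[OF fiber, of x x c] by simp

lemma origin_mem: "t \<in> topspace T \<Longrightarrow> origin t \<in> topspace E \<and> p (origin t) = t"
  using banach_space_on.origin_closed[OF banach_fiber, of t] by simp

text \<open>Subtraction is continuous on pairs in a common fiber, so the preimage of
  \<open>N\<close> is relatively open there. \<open>A\<close> is an open set of the full product
  that cuts it out; open rectangles can then be found inside \<open>A\<close>.\<close>

lemma openin_preimage_fiber_diff:
  assumes "openin E N"
  obtains A where "openin (prod_topology E E) A"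
    and "\<And>x y. \<lbrakk>x \<in> topspace E; y \<in> topspace E; p x = p y\<rbrakk> \<Longrightarrow>
           (x, y) \<in> A \<longleftrightarrow> add x (smult (- 1) y) \<in> N"
proof -
  let ?P = "prod_topology E E" and ?D = "{(x, y). p x = p y}"
  have "continuous_map E (prod_topology euclidean E) (\<lambda>y. (- 1 :: 'k, y))"
    by (simp add: continuous_map_pairedI)
  then have neg: "continuous_map E E (\<lambda>y. smult (- 1) y)"
    using continuous_map_compose[OF _ continuous_smult] by (fastforce simp: o_def)
  have "continuous_map ?P ?P (\<lambda>z. (fst z, smult (- 1) (snd z)))"
    by (intro continuous_map_pairedI continuous_map_fst
        continuous_map_compose[OF continuous_map_snd neg, unfolded o_def])
  \<comment> \<open>Negating the second entry preserves fibers, so the map restricts to the domain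
    on which \<open>add\<close> is continuous.\<close>
  then have "continuous_map (subtopology ?P ?D) (subtopology ?P ?D) (\<lambda>z. (fst z, smult (- 1) (snd z)))"
    by (auto simp: continuous_map_in_subtopology continuous_map_from_subtopology smult_mem)
  from continuous_map_compose[OF this continuous_add]
  have "continuous_map (subtopology ?P ?D) E (\<lambda>z. add (fst z) (smult (- 1) (snd z)))"
    by (simp add: o_def)
  from openin_continuous_map_preimage[OF this assms]
  obtain A where A: "openin ?P A"
    "{z \<in> topspace (subtopology ?P ?D). add (fst z) (smult (- 1) (snd z)) \<in> N} = A \<inter> ?D"
    unfolding openin_subtopology by blast
  have "(x, y) \<in> A \<longleftrightarrow> add x (smult (- 1) y) \<in> N"
    if "x \<in> topspace E" "y \<in> topspace E" "p x = p y" for x y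
    using that arg_cong[OF A(2), of "\<lambda>S. (x, y) \<in> S"] by simp
  with A(1) show ?thesis by (rule that)
qed

text \<open>\<open>origin_limit\<close> is applied to the filter generated by the tubes themselves:
  since it converges to the origin, \<open>N\<close> contains one of them.\<close>

lemma origin_neighborhood_tube:
  assumes t: "t \<in> topspace T" and N: "openin E N" "origin t \<in> N"
  obtains V e where "openin T V" "t \<in> V" "e > 0"
    "\<And>z. \<lbrakk>z \<in> topspace E; p z \<in> V; nrm z < e\<rbrakk> \<Longrightarrow> z \<in> N"
proof -
  \<comment> \<open>The coarsest filter living on the carrier along which \<open>p\<close> tends to
    \<open>t\<close> and \<open>nrm\<close> tends to \<open>0\<close>.\<close>
  define F where "F = inf (filtercomap p (nhdsin T t))
    (inf (filtercomap nrm (nhds 0)) (principal (topspace E)))"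
  have "eventually (\<lambda>x. x \<in> topspace E) F"
    unfolding F_def inf_assoc[symmetric] eventually_inf_principal by simp
  moreover have "limitin T p t F"
    unfolding limitin_def
  proof (intro conjI allI impI t)
    fix U assume "openin T U \<and> t \<in> U"
    then have "eventually (\<lambda>s. s \<in> U) (nhdsin T t)"
      using eventually_nhdsin[of "\<lambda>s. s \<in> U" T t] t by blast
    then have "eventually (\<lambda>x. p x \<in> U) (filtercomap p (nhdsin T t))"
      by (rule eventually_filtercomapI)
    then show "eventually (\<lambda>x. p x \<in> U) F"
      unfolding F_def by (rule filter_leD[OF inf_le1])
  qed
  moreover have "(nrm \<longlongrightarrow> 0) F"
    unfolding F_def filterlim_iff_le_filtercomap by (simp add: le_infI1 le_infI2)
  ultimately have "limitin E (\<lambda>x. x) (origin t) F"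
    by (rule origin_limit[OF t])
  then have "eventually (\<lambda>x. x \<in> N) F"
    using N by (simp add: limitin_def)
  then obtain P Q where P: "eventually P (filtercomap p (nhdsin T t))"
    and Q: "eventually Q (filtercomap nrm (nhds 0))"
    and PQ: "\<And>x. P x \<Longrightarrow> Q x \<Longrightarrow> x \<in> topspace E \<Longrightarrow> x \<in> N"
    unfolding F_def eventually_inf eventually_principal by blast
  obtain V where V: "openin T V" "t \<in> V" "\<And>x. p x \<in> V \<Longrightarrow> P x"
    using P t unfolding eventually_filtercomap eventually_nhdsin by blast
  obtain e where e: "e > 0" "\<And>x. dist (nrm x) 0 < e \<Longrightarrow> Q x"
    using Q unfolding eventually_filtercomap eventually_nhds_metric by blast
  show ?thesis
  proof (rule that[OF V(1,2) e(1)])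
    fix z assume z: "z \<in> topspace E" "p z \<in> V" "nrm z < e"
    have "0 \<le> nrm z"
      using banach_space_on.nrm_nonneg[OF fiber[OF z(1)]] z(1) by simp
    then show "z \<in> N" using z V(3) e(2) PQ by simp
  qed
qed

text \<open>Fiberwise subtraction is continuous at two pairs. At \<open>(x, x)\<close> its value is
  the origin, of norm \<open>0 < r\<close>, which bounds the diameter; at
  \<open>(x, origin (p x))\<close> its value is \<open>x\<close>, which lies in \<open>W\<close>,
  and this gives the uniform margin \<open>e\<close>.\<close>

lemma small_fiberwise_neighborhood:
  assumes W: "openin E W" and x: "x \<in> W" and r: "r > 0"
  obtains W' e where "openin E W'" "x \<in> W'" "W' \<subseteq> W" "e > 0"
    "\<And>y z. \<lbrakk>y \<in> W'; z \<in> W'; p y = p z\<rbrakk> \<Longrightarrow> nrm (add y (smult (- 1) z)) < r"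
    "\<And>y z. \<lbrakk>y \<in> W'; z \<in> topspace E; p y = p z; nrm (add y (smult (- 1) z)) < e\<rbrakk> \<Longrightarrow> z \<in> W"
proof -
  have xE: "x \<in> topspace E" using openin_subset[OF W] x by blast
  interpret B: banach_space_on "{y \<in> topspace E. p y = p x}" add "origin (p x)" smult nrm
    by (rule fiber[OF xE])
  note o = origin_mem[OF proj_mem[OF xE]]
  have xx: "add x (smult (- 1) x) = origin (p x)" and nrm0: "nrm (origin (p x)) = 0"
    using B.diff_self xE B.nrm_eq_0[OF B.origin_closed] by auto
  have xo: "add x (smult (- 1) (origin (p x))) = x"
    using B.add_diff_cancel[of x x] xE xx by simp
  obtain A where A: "openin (prod_topology E E) A" "\<And>y z. \<lbrakk>y \<in> topspace E; z \<in> topspace E; p y = p z\<rbrakk> \<Longrightarrow>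
           (y, z) \<in> A \<longleftrightarrow> add y (smult (- 1) z) \<in> {u \<in> topspace E. nrm u < r}"
    using openin_preimage_fiber_diff[OF upper_semicontinuous_nrm] by blast
  have "(x, x) \<in> A" using A(2)[OF xE xE] xx o nrm0 r by simp
  then obtain A1 A2 where A12: "openin E A1" "openin E A2" "x \<in> A1" "x \<in> A2" "A1 \<times> A2 \<subseteq> A"
    using A(1)[unfolded openin_prod_topology_alt, rule_format] by metis
  obtain C where C: "openin (prod_topology E E) C" "\<And>y z. \<lbrakk>y \<in> topspace E; z \<in> topspace E; p y = p z\<rbrakk> \<Longrightarrow>
           (y, z) \<in> C \<longleftrightarrow> add y (smult (- 1) z) \<in> W"
    using openin_preimage_fiber_diff[OF W] by blast
  have "(x, origin (p x)) \<in> C" using C(2)[OF xE] o xo x by simp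
  then obtain C1 C2 where C12: "openin E C1" "openin E C2" "x \<in> C1" "origin (p x) \<in> C2" "C1 \<times> C2 \<subseteq> C"
    using C(1)[unfolded openin_prod_topology_alt, rule_format] by metis
  obtain V e where V: "openin T V" "p x \<in> V" "e > 0"
    "\<And>z. \<lbrakk>z \<in> topspace E; p z \<in> V; nrm z < e\<rbrakk> \<Longrightarrow> z \<in> C2"
    using origin_neighborhood_tube[OF proj_mem[OF xE] C12(2,4)] by blast
  \<comment> \<open>Both points of a pair come from \<open>W'\<close>, hence both \<open>A1\<close>
    and \<open>A2\<close>. \<open>C1\<close> holds the minuend, and \<open>V\<close> places its
    fiber in the range of the tube.\<close>
  define W' where "W' = W \<inter> A1 \<inter> A2 \<inter> C1 \<inter> {y \<in> topspace E. p y \<in> V}"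
  show ?thesis
  proof (rule that[of W' e])
    show "openin E W'"
      unfolding W'_def
      by (intro openin_Int W A12 C12 openin_continuous_map_preimage[OF continuous_proj V(1)])
    show "x \<in> W'" "W' \<subseteq> W" "e > 0"
      using x xE A12 C12 V by (auto simp: W'_def)
    show "nrm (add y (smult (- 1) z)) < r" if "y \<in> W'" "z \<in> W'" "p y = p z" for y z
      using that A12(5) A(2)[of y z] by (auto simp: W'_def)
    show "z \<in> W"
      if yz: "y \<in> W'" "z \<in> topspace E" "p y = p z" "nrm (add y (smult (- 1) z)) < e" for y z
    proof -
      have y: "y \<in> topspace E" "p y \<in> V" "y \<in> C1" using yz by (auto simp: W'_def)
      interpret Y: banach_space_on "{u \<in> topspace E. p u = p y}" add "origin (p y)" smult nrm
        by (rule fiber[OF y(1)])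
      let ?d = "add y (smult (- 1) z)"
      have d: "?d \<in> topspace E" "p ?d = p y"
        using Y.diff_closed[of y z] y yz by auto
      then have "?d \<in> C2" using V(4) y yz by simp
      \<comment> \<open>The difference \<open>?d\<close> lies in the tube, hence in
        \<open>C2\<close>; subtracting it from \<open>y\<close> stays in \<open>W\<close> and gives
        back \<open>z\<close>.\<close>
      then have "add y (smult (- 1) ?d) \<in> W"
        using C(2)[of y ?d] C12(5) y d by auto
      then show "z \<in> W"
        using Y.add_diff_cancel[of y z] y yz by simp
    qed
  qed
qed

section \<open>Shrinking an open set together with its projection\<close>

lemma open_restrict_base:
  assumes "openin E W" "openin T B" "B \<subseteq> p ` W"
  shows "openin E {x \<in> W. p x \<in> B}" "p ` {x \<in> W. p x \<in> B} = B"
proof -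
  have "{x \<in> W. p x \<in> B} = W \<inter> {x \<in> topspace E. p x \<in> B}"
    using openin_subset[OF assms(1)] by blast
  then show "openin E {x \<in> W. p x \<in> B}"
    using assms openin_continuous_map_preimage[OF continuous_proj] by auto
qed (use assms(3) in blast)

text \<open>Shrink first in the bundle, around a point of \<open>W \<inter> G\<close>, and then in
  the base. Cutting down to the part over a smaller open set keeps both conditions on differences
  and makes that set the exact projection.\<close>

lemma Baire_step:
  assumes B: "pseudo_base T B" and T: "quasi_regular_space T"
    and W: "openin E W" "W \<noteq> {}" and G: "openin E G" "E closure_of G = topspace E" and r: "r > 0"
  obtains W' e where "openin E W'" "W' \<noteq> {}" "W' \<subseteq> W \<inter> G" "p ` W' \<in> B"
    "T closure_of (p ` W') \<subseteq> p ` W" "e > 0"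
    "\<And>y z. \<lbrakk>y \<in> W'; z \<in> W'; p y = p z\<rbrakk> \<Longrightarrow> nrm (add y (smult (- 1) z)) < r"
    "\<And>y z. \<lbrakk>y \<in> W'; z \<in> topspace E; p y = p z; nrm (add y (smult (- 1) z)) < e\<rbrakk> \<Longrightarrow> z \<in> W"
proof -
  have WG: "openin E (W \<inter> G)" using W G by blast
  obtain x where x: "x \<in> W \<inter> G"
    using G(2) W unfolding dense_intersects_open by blast
  obtain W1 e where W1: "openin E W1" "x \<in> W1" "W1 \<subseteq> W \<inter> G" "e > 0"
    "\<And>y z. \<lbrakk>y \<in> W1; z \<in> W1; p y = p z\<rbrakk> \<Longrightarrow> nrm (add y (smult (- 1) z)) < r"
    "\<And>y z. \<lbrakk>y \<in> W1; z \<in> topspace E; p y = p z; nrm (add y (smult (- 1) z)) < e\<rbrakk> \<Longrightarrow> z \<in> W \<inter> G"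
    using small_fiberwise_neighborhood[OF WG x r] by blast
  have "openin T (p ` W1)" "p ` W1 \<noteq> {}"
    using W1 open_proj unfolding open_map_def by auto
  \<comment> \<open>A member of \<open>B\<close> comes with no control on its closure, so
    quasi-regularity is used before \<open>B\<close>; the closure of any subset of \<open>V\<close>
    then stays in the projection of \<open>W1\<close>.\<close>
  then obtain V where V: "openin T V" "V \<noteq> {}" "T closure_of V \<subseteq> p ` W1"
    using T unfolding quasi_regular_space_def by blast
  then obtain U where U: "U \<in> B" "U \<subseteq> V" "openin T U" "U \<noteq> {}"
    using B unfolding pseudo_base_def by blast
  have cl: "T closure_of U \<subseteq> p ` W1"
    using closure_of_mono[OF U(2)] V(3) by blast
  then have "U \<subseteq> p ` W1"
    using closure_of_subset[OF openin_subset[OF U(3)]] by blast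
  note R = open_restrict_base[OF W1(1) U(3) this]
  show ?thesis
  proof (rule that[of "{x \<in> W1. p x \<in> U}" e])
    show "{x \<in> W1. p x \<in> U} \<noteq> {}" using R(2) U(4) by blast
    show "T closure_of (p ` {x \<in> W1. p x \<in> U}) \<subseteq> p ` W"
      using cl W1(3) unfolding R(2) by blast
  qed (use R U W1 in auto)
qed

text \<open>Points chosen over \<open>t\<close> form a Cauchy sequence by \<open>diam\<close>. The
  sets are not closed, so \<open>nbhd\<close> is what brings the limit back into each of
  them.\<close>

lemma nested_fiberwise_limit:
  fixes W :: "nat \<Rightarrow> 'e set" and e :: "nat \<Rightarrow> real"
  assumes t: "\<And>n. t \<in> p ` W n"
    and WE: "\<And>n. W n \<subseteq> topspace E" and dec: "\<And>n. W (Suc n) \<subseteq> W n" and e: "\<And>n. e n > 0"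
    and diam: "\<And>n y z. \<lbrakk>y \<in> W (Suc n); z \<in> W (Suc n); p y = p z\<rbrakk> \<Longrightarrow>
          nrm (add y (smult (- 1) z)) < inverse (real (Suc n))"
    and nbhd: "\<And>n y z. \<lbrakk>y \<in> W (Suc n); z \<in> topspace E; p y = p z;
          nrm (add y (smult (- 1) z)) < e n\<rbrakk> \<Longrightarrow> z \<in> W n"
  shows "\<exists>l. \<forall>n. l \<in> W n"
proof -
  have "\<forall>n. \<exists>x. x \<in> W n \<and> p x = t" using t by blast
  then obtain s where s: "\<And>n. s n \<in> W n" "\<And>n. p (s n) = t" by metis
  have sE: "s n \<in> topspace E" for n using s(1) WE by blast
  have tT: "t \<in> topspace T" using proj_mem[OF sE, of 0] s(2) by simp
  interpret B: banach_space_on "{y \<in> topspace E. p y = t}" add "origin t" smult nrm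
    by (rule banach_fiber[OF tT])
  have sW: "s m \<in> W n" if "n \<le> m" for m n
    using s(1) lift_Suc_antimono_le[of W, OF dec that] by blast
  have "\<exists>l\<in>{y \<in> topspace E. p y = t}. (\<lambda>n. nrm (add (s n) (smult (- 1) l))) \<longlonglongrightarrow> 0"
  proof (rule B.complete)
    show "s n \<in> {y \<in> topspace E. p y = t}" for n using sE s(2) by simp
    fix d :: real assume "d > 0"
    then obtain N where N: "inverse (real (Suc N)) < d" using reals_Archimedean by blast
    \<comment> \<open>\<open>diam\<close> at index \<open>N\<close> concerns
      \<open>W (Suc N)\<close>, so the tail starts at \<open>Suc N\<close>.\<close>
    have "nrm (add (s m) (smult (- 1) (s n))) < d" if "m \<ge> Suc N" "n \<ge> Suc N" for m n
      using diam[of "s m" N "s n"] sW that s(2) N by fastforce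
    then show "\<exists>N. \<forall>m\<ge>N. \<forall>n\<ge>N. nrm (add (s m) (smult (- 1) (s n))) < d" by blast
  qed
  then obtain l where l: "l \<in> topspace E" "p l = t"
    and lim: "(\<lambda>n. nrm (add (s n) (smult (- 1) l))) \<longlonglongrightarrow> 0" by blast
  have "l \<in> W n" for n
  proof -
    \<comment> \<open>\<open>nbhd\<close> leads from \<open>W (Suc n)\<close> to \<open>W n\<close>,
      so \<open>s m\<close> must be close to \<open>l\<close> and also lie in
      \<open>W (Suc n)\<close>.\<close>
    have "eventually (\<lambda>m. nrm (add (s m) (smult (- 1) l)) < e n \<and> Suc n \<le> m) sequentially"
      using order_tendstoD(2)[OF lim e] eventually_ge_at_top by (rule eventually_conj)
    then obtain m where "nrm (add (s m) (smult (- 1) l)) < e n" "Suc n \<le> m"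
      using eventually_happens trivial_limit_sequentially by blast
    then show ?thesis
      using nbhd[of "s m" n l] sW s(2) l by simp
  qed
  then show ?thesis by blast
qed

section \<open>The nested sequence and its common point\<close>

theorem Baire_space_if_pseudo_complete:
  assumes T: "pseudo_complete_space T"
  shows "Baire_space E"
proof (rule Baire_spaceI)
  fix G :: "nat \<Rightarrow> 'e set" and O'
  assume G: "\<And>n. openin E (G n)" "\<And>n. E closure_of G n = topspace E"
    and O': "openin E O'" "O' \<noteq> {}"
  obtain B where qr: "quasi_regular_space T" and B: "\<And>n::nat. pseudo_base T (B n)"
    and inter: "\<And>U. (\<And>n. U n \<in> B n \<and> T closure_of (U (Suc n)) \<subseteq> U n) \<Longrightarrow> (\<Inter>n. U n) \<noteq> {}"
    using T unfolding pseudo_complete_space_def by blast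
  \<comment> \<open>\<open>P\<close> is the invariant of a single stage and \<open>Q\<close> the
    relation between consecutive stages, as dependent choice requires. \<open>G n\<close> enters in
    the passage from \<open>n\<close> to \<open>Suc n\<close>.\<close>
  define P where "P n W \<longleftrightarrow> openin E W \<and> W \<noteq> {} \<and> W \<subseteq> O' \<and> p ` W \<in> B n" for n W
  define Q where "Q n W W' \<longleftrightarrow> W' \<subseteq> W \<inter> G n \<and> T closure_of (p ` W') \<subseteq> p ` W \<and>
    (\<forall>y z. y \<in> W' \<longrightarrow> z \<in> W' \<longrightarrow> p y = p z \<longrightarrow> nrm (add y (smult (- 1) z)) < inverse (real (Suc n))) \<and>
    (\<exists>e>0. \<forall>y z. y \<in> W' \<longrightarrow> z \<in> topspace E \<longrightarrow> p y = p z \<longrightarrow>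
       nrm (add y (smult (- 1) z)) < e \<longrightarrow> z \<in> W)" for n W W'
  have "\<exists>W. P 0 W"
  proof -
    \<comment> \<open>The start only has to lie in \<open>O'\<close> and project into
      \<open>B 0\<close>; the radius \<open>1\<close> and the set \<open>G 0\<close> are arbitrary
      choices here.\<close>
    obtain W' where "openin E W'" "W' \<noteq> {}" "W' \<subseteq> O' \<inter> G 0" "p ` W' \<in> B 0"
      using Baire_step[OF B qr O' G zero_less_one] by metis
    then show ?thesis unfolding P_def by blast
  qed
  moreover have "\<exists>W'. P (Suc n) W' \<and> Q n W W'" if "P n W" for n W
  proof -
    have W: "openin E W" "W \<noteq> {}" "W \<subseteq> O'" using that by (auto simp: P_def)
    have r: "inverse (real (Suc n)) > 0" by simp
    obtain W' e where W': "openin E W'" "W' \<noteq> {}" "W' \<subseteq> W \<inter> G n" "p ` W' \<in> B (Suc n)"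
      "T closure_of (p ` W') \<subseteq> p ` W" "e > 0"
      "\<And>y z. \<lbrakk>y \<in> W'; z \<in> W'; p y = p z\<rbrakk> \<Longrightarrow> nrm (add y (smult (- 1) z)) < inverse (real (Suc n))"
      "\<And>y z. \<lbrakk>y \<in> W'; z \<in> topspace E; p y = p z; nrm (add y (smult (- 1) z)) < e\<rbrakk> \<Longrightarrow> z \<in> W"
      using Baire_step[OF B[of "Suc n"] qr W(1,2) G[of n] r] by metis
    then have "P (Suc n) W'" using W(3) unfolding P_def by blast
    moreover have "Q n W W'" using W' unfolding Q_def by blast
    ultimately show ?thesis by blast
  qed
  ultimately obtain W where W: "\<And>n. P n (W n)" "\<And>n. Q n (W n) (W (Suc n))"
    using dependent_nat_choice[of P Q] by metis
  \<comment> \<open>The projections satisfy the nesting condition for the sequence \<open>B\<close>,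
    so pseudo-completeness supplies a fiber that meets every \<open>W n\<close>.\<close>
  obtain t where t: "\<And>n. t \<in> p ` W n"
  proof -
    have "p ` W n \<in> B n \<and> T closure_of (p ` W (Suc n)) \<subseteq> p ` W n" for n
      using W(1)[of n] W(2)[of n] unfolding P_def Q_def by blast
    from inter[of "\<lambda>n. p ` W n", OF this] show ?thesis using that by blast
  qed
  have "\<exists>e>0. \<forall>y z. y \<in> W (Suc n) \<longrightarrow> z \<in> topspace E \<longrightarrow> p y = p z \<longrightarrow>
       nrm (add y (smult (- 1) z)) < e \<longrightarrow> z \<in> W n" for n
    using W(2)[of n] unfolding Q_def by (elim conjE)
  then obtain e where e: "\<And>n. e n > 0"
    "\<And>n y z. \<lbrakk>y \<in> W (Suc n); z \<in> topspace E; p y = p z;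
       nrm (add y (smult (- 1) z)) < e n\<rbrakk> \<Longrightarrow> z \<in> W n"
    by metis
  have "\<exists>l. \<forall>n. l \<in> W n"
  proof (rule nested_fiberwise_limit[OF t _ _ e(1) _ e(2)])
    show "W n \<subseteq> topspace E" for n
      using W(1)[of n] openin_subset unfolding P_def by blast
    show "W (Suc n) \<subseteq> W n" for n using W(2)[of n] unfolding Q_def by blast
    show "nrm (add y (smult (- 1) z)) < inverse (real (Suc n))"
      if "y \<in> W (Suc n)" "z \<in> W (Suc n)" "p y = p z" for n y z
      using W(2)[of n] that unfolding Q_def by blast
  qed
  then obtain l where l: "\<And>n. l \<in> W n" by blast
  have "l \<in> O'" using l W(1)[of 0] unfolding P_def by blast
  moreover have "l \<in> G n" for n
    using l W(2)[of n] unfolding Q_def by blast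
  ultimately show "\<exists>x\<in>O'. \<forall>n. x \<in> G n" by blast
qed

end

theorem propositionA2:
  fixes E :: "'e topology" and p :: "'e \<Rightarrow> 't" and T :: "'t topology"
    and add :: "'e \<Rightarrow> 'e \<Rightarrow> 'e" and origin :: "'t \<Rightarrow> 'e"
    and smult :: "'k::real_normed_field \<Rightarrow> 'e \<Rightarrow> 'e" and nrm :: "'e \<Rightarrow> real"
  assumes "banach_bundle E p T add origin smult nrm"
    and "pseudo_complete_space T"
    and "locally_paracompact_space T"
  shows "Baire_space E"
  using assms(1,2) by (rule banach_bundle.Baire_space_if_pseudo_complete)

end
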